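(* Let $n,k$ be positive integers with $k\leq n$, and write $n=kq+r$ with integers $q,r$ and $0\leq r<k$. Let $G$ be a graph on $n$ vertices with exactly $k$ connected components. Then $$F(G)\geq r(q+1)+\frac{kq(q+1)}{2},$$ with equality if and only if $G$ is isomorphic to $rP_{q+1}\cup (k-r)P_q$.
   Context: All graphs are finite, simple and undirected. A connected subgraph of a graph $G=(V,E)$ is a graph $(V',E')$ with $\emptyset\neq V'\subseteq V$, $E'\subseteq E$, every edge of $E'$ having both endpoints in $V'$, and $(V',E')$ connected; distinct pairs $(V',E')$ are counted separately. The core index $F(G)$ is the number of connected subgraphs of $G$ (for a disconnected graph it is the sum over its components). $P_m$ is the path on $m$ vertices, $\cup$ denotes disjoint union and $mG$ the disjoint union of $m$ copies of $G$. *)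

theory Defs
  imports Complex_Main
    "Graph_Theory.Pair_Digraph"
    "Graph_Theory.Digraph_Component"
    "Graph_Theory.Digraph_Isomorphism"
begin

text \<open>
  A finite simple undirected graph is a \<^const>\<open>pair_graph\<close>: each undirected edge is
  represented by its two opposite arcs. Hence subgraphs of the undirected graph correspond to
  those subgraphs of the digraph whose arc set is symmetric, which has to be required explicitly.
  Connected graphs are nonempty by the definition of \<^const>\<open>Digraph_Component.connected\<close>.
\<close>

definition connected_subgraphs :: "'a pair_pre_digraph \<Rightarrow> 'a pair_pre_digraph set" where
  "connected_subgraphs G =
     {H. subgraph (with_proj H) (with_proj G) \<and> symmetric (with_proj H) \<and>
         Digraph_Component.connected (with_proj H)}"

definition core_index :: "'a pair_pre_digraph \<Rightarrow> nat" where
  "core_index G = card (connected_subgraphs G)"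

text \<open>
  Symmetry need not be required here: in a symmetric digraph a maximal (weakly) connected
  subgraph contains all arcs between its vertices.
\<close>

definition graph_components :: "'a pair_pre_digraph \<Rightarrow> ('a, 'a \<times> 'a) pre_digraph set" where
  "graph_components G =
     {H. pre_digraph.max_subgraph (with_proj G) Digraph_Component.connected H}"

definition path_graph :: "nat \<Rightarrow> nat pair_pre_digraph" where
  "path_graph m =
     \<lparr> pverts = {..<m}, parcs = {(i, j). i < m \<and> j < m \<and> (j = Suc i \<or> i = Suc j)} \<rparr>"

definition disjoint_union ::
    "'a pair_pre_digraph \<Rightarrow> 'b pair_pre_digraph \<Rightarrow> ('a + 'b) pair_pre_digraph" where
  "disjoint_union G H =
     \<lparr> pverts = pverts G <+> pverts H,
       parcs = {(Inl u, Inl v) | u v. (u, v) \<in> parcs G} \<union>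
               {(Inr u, Inr v) | u v. (u, v) \<in> parcs H} \<rparr>"

definition copies :: "nat \<Rightarrow> 'a pair_pre_digraph \<Rightarrow> (nat \<times> 'a) pair_pre_digraph" where
  "copies m G =
     \<lparr> pverts = {..<m} \<times> pverts G,
       parcs = {((c, u), (c, v)) | c u v. c < m \<and> (u, v) \<in> parcs G} \<rparr>"

end

theory Submission
  imports Defs
begin

text \<open>Any two (possibly equal) vertices \<open>u\<close>, \<open>v\<close> of the same component are joined by a path, and a
  path determines its set of ends \<open>{u, v}\<close>. Choosing one path for each such set gives
  \<open>F(G) \<ge> \<Sum> s (s + 1) / 2\<close>, where \<open>s\<close> ranges over the sizes of the components. If equality holds,
  every connected subgraph is one of the chosen paths; in particular every component is a path.
  Conversely, a connected subgraph of a disjoint union of paths is a segment of one of them.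
  Finally, \<open>(s - q) (s - q - 1) \<ge> 0\<close>, with equality iff \<open>s \<in> {q, q + 1}\<close>; summed over the components
  this bounds \<open>\<Sum> s (s + 1) / 2\<close> below by \<open>r (q + 1) + k q (q + 1) / 2\<close>.\<close>

section \<open>Paths as vertex lists\<close>

text \<open>A list keeps the ends of a path at hand as \<open>hd\<close> and \<open>last\<close>. A
  singleton list is the trivial path, whose two ends coincide.\<close>

definition list_graph :: "'a list \<Rightarrow> 'a pair_pre_digraph" where
  "list_graph p = \<lparr>pverts = set p,
     parcs = {(p ! i, p ! j) | i j. i < length p \<and> j < length p \<and> (j = Suc i \<or> i = Suc j)}\<rparr>"

lemma pverts_list_graph [simp]: "pverts (list_graph p) = set p"
  by (simp add: list_graph_def)

lemma in_parcs_list_graph: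
  "(u, v) \<in> parcs (list_graph p) \<longleftrightarrow>
     (\<exists>i j. i < length p \<and> j < length p \<and> (j = Suc i \<or> i = Suc j) \<and> u = p ! i \<and> v = p ! j)"
  by (auto simp: list_graph_def)

lemma sym_parcs_list_graph: "sym (parcs (list_graph p))"
  unfolding sym_def in_parcs_list_graph by blast

text \<open>Walking along the list reaches every vertex from the first one, and the symmetry of the
  arcs allows such a walk to be reversed.\<close>

lemma rtrancl_parcs_list_graph:
  assumes "u \<in> set p" "v \<in> set p"
  shows "(u, v) \<in> (parcs (list_graph p))\<^sup>*"
proof -
  have from_hd: "(p ! 0, p ! i) \<in> (parcs (list_graph p))\<^sup>*" if "i < length p" for i
    using that
  proof (induction i)
    case (Suc i)
    then have "(p ! i, p ! Suc i) \<in> parcs (list_graph p)"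
      unfolding in_parcs_list_graph by (metis Suc_lessD)
    with Suc show ?case by (meson Suc_lessD rtrancl.rtrancl_into_rtrancl)
  qed simp
  obtain i j where "i < length p" "u = p ! i" "j < length p" "v = p ! j"
    using assms by (auto simp: in_set_conv_nth)
  then show ?thesis
    using from_hd sym_rtrancl[OF sym_parcs_list_graph[of p]] by (meson rtrancl_trans symD)
qed

text \<open>The end vertices are recovered from the graph as the vertices of degree at most one.\<close>

lemma ends_list_graph:
  assumes "distinct p" "p \<noteq> []"
  shows "{hd p, last p} = {v \<in> set p. \<forall>w w'. (v, w) \<in> parcs (list_graph p) \<longrightarrow>
           (v, w') \<in> parcs (list_graph p) \<longrightarrow> w = w'}"
proof (intro equalityI subsetI)
  fix v assume "v \<in> {hd p, last p}"
  then obtain i where i: "v = p ! i" "i < length p" "i = 0 \<or> Suc i = length p"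
    using assms(2) by (auto simp: hd_conv_nth last_conv_nth)
  have "w = w'" if w: "(v, w) \<in> parcs (list_graph p)" "(v, w') \<in> parcs (list_graph p)" for w w'
  proof -
    from w(1) obtain j where j: "j < length p" "j = Suc i \<or> i = Suc j" "w = p ! j"
      using i assms(1) by (auto simp: in_parcs_list_graph nth_eq_iff_index_eq)
    from w(2) obtain j' where j': "j' < length p" "j' = Suc i \<or> i = Suc j'" "w' = p ! j'"
      using i assms(1) by (auto simp: in_parcs_list_graph nth_eq_iff_index_eq)
    \<comment> \<open>\<open>i = 0\<close> excludes a preceding position and
      \<open>Suc i = length p\<close> a following one, so only one of the two neighbouring positions
      can occur.\<close>
    from j j' i(3) have "j = j'" by auto
    with j j' show ?thesis by simp
  qed
  with i show "v \<in> {v \<in> set p. \<forall>w w'. (v, w) \<in> parcs (list_graph p) \<longrightarrow>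
      (v, w') \<in> parcs (list_graph p) \<longrightarrow> w = w'}"
    by auto
next
  fix v assume v: "v \<in> {v \<in> set p. \<forall>w w'. (v, w) \<in> parcs (list_graph p) \<longrightarrow>
      (v, w') \<in> parcs (list_graph p) \<longrightarrow> w = w'}"
  then obtain i where i: "v = p ! i" "i < length p" by (auto simp: in_set_conv_nth)
  show "v \<in> {hd p, last p}"
  proof (cases "i = 0 \<or> Suc i = length p")
    case True
    with i assms(2) show ?thesis
      by (metis diff_Suc_1 hd_conv_nth insert_iff last_conv_nth)
  next
    case False
    then obtain j where j: "i = Suc j" "Suc i < length p"
      using i by (metis Suc_lessI not0_implies_Suc)
    \<comment> \<open>An inner vertex has both a predecessor and a successor on the list, and these
      differ because \<open>p\<close> is distinct.\<close>
    have "(v, p ! j) \<in> parcs (list_graph p)" "(v, p ! Suc i) \<in> parcs (list_graph p)"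
      unfolding in_parcs_list_graph using i j by (metis Suc_lessD)+
    with v have "p ! j = p ! Suc i" by blast
    with j assms(1) i show ?thesis by (simp add: nth_eq_iff_index_eq)
  qed
qed

text \<open>The path grows by one arc at a time; if the new vertex already lies on it, the path is
  cut back to that vertex instead.\<close>

lemma rtrancl_distinct_list:
  assumes "(u, v) \<in> A\<^sup>*"
  shows "\<exists>p. p \<noteq> [] \<and> distinct p \<and> hd p = u \<and> last p = v \<and>
           (\<forall>i. Suc i < length p \<longrightarrow> (p ! i, p ! Suc i) \<in> A)"
  using assms
proof (induction rule: rtrancl_induct)
  case base
  show ?case by (rule exI[of _ "[u]"]) simp
next
  case (step y z)
  then obtain p where p: "p \<noteq> []" "distinct p" "hd p = u" "last p = y"
    "\<And>i. Suc i < length p \<Longrightarrow> (p ! i, p ! Suc i) \<in> A" by blast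
  show ?case
  proof (cases "z \<in> set p")
    case True
    then obtain i where i: "i < length p" "z = p ! i" by (auto simp: in_set_conv_nth)
    then have "last (take (Suc i) p) = z" by (simp add: take_Suc_conv_app_nth)
    with p show ?thesis by (intro exI[of _ "take (Suc i) p"]) auto
  next
    case False
    have "((p @ [z]) ! i, (p @ [z]) ! Suc i) \<in> A" if "Suc i < length (p @ [z])" for i
    proof (cases "Suc i < length p")
      case False
      with that have i: "Suc i = length p" by simp
      then have "p ! i = y" using p(1,4) by (metis diff_Suc_1 last_conv_nth)
      with i step.hyps(2) show ?thesis by (auto simp: nth_append)
    qed (use p in \<open>auto simp: nth_append\<close>)
    with False p show ?thesis by (intro exI[of _ "p @ [z]"]) auto
  qed
qed

section \<open>Connected subgraphs as pairs of sets\<close>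

text \<open>\<open>connected\<close> asks for mutual reachability in the symmetric closure, which
  for symmetric \<open>H\<close> is reachability in \<open>H\<close> itself.\<close>

lemma connected_iff_rtrancl:
  fixes H :: "'a pair_pre_digraph"
  assumes "pair_wf_digraph H" "symmetric (with_proj H)"
  shows "Digraph_Component.connected (with_proj H) \<longleftrightarrow>
    pverts H \<noteq> {} \<and> (\<forall>u\<in>pverts H. \<forall>v\<in>pverts H. (u, v) \<in> (parcs H)\<^sup>*)"
proof -
  interpret H: pair_wf_digraph H by fact
  show ?thesis
    unfolding connected_def strongly_connected_def
    using H.reachable_mk_symmetric_eq[OF assms(2)] H.reachable_conv'
    by (auto simp: mk_symmetric_def)
qed

text \<open>Reduces membership to conditions on two sets. Well-formedness of \<open>H\<close>
  becomes the inclusion of \<open>parcs H\<close> in the square of \<open>pverts H\<close>.\<close>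

lemma (in pair_graph) in_connected_subgraphs:
  "H \<in> connected_subgraphs G \<longleftrightarrow>
     pverts H \<subseteq> pverts G \<and> parcs H \<subseteq> parcs G \<and> parcs H \<subseteq> pverts H \<times> pverts H \<and>
     sym (parcs H) \<and> pverts H \<noteq> {} \<and> (\<forall>u\<in>pverts H. \<forall>v\<in>pverts H. (u, v) \<in> (parcs H)\<^sup>*)"
proof -
  have wf: "pair_wf_digraph H \<longleftrightarrow> parcs H \<subseteq> pverts H \<times> pverts H"
    by (auto simp: pair_wf_digraph_def)
  have "wf_digraph (with_proj G)" by unfold_locales
  then show ?thesis
    unfolding connected_subgraphs_def mem_Collect_eq subgraph_def wf_digraph_wp_iff wf[symmetric]
    using connected_iff_rtrancl[of H]
    by (auto simp: compatible_def symmetric_def wf_digraph_wp_iff)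
qed

text \<open>A subgraph is determined by its vertex set and its arc set, both subsets of finite sets.
  This makes \<open>core_index\<close> a genuine count, since \<open>card\<close> is 0 on infinite
  sets.\<close>

lemma (in pair_graph) finite_connected_subgraphs: "finite (connected_subgraphs G)"
proof (rule finite_imageD)
  show "finite ((\<lambda>H. (pverts H, parcs H)) ` connected_subgraphs G)"
  proof (rule finite_subset)
    show "(\<lambda>H. (pverts H, parcs H)) ` connected_subgraphs G \<subseteq> Pow (pverts G) \<times> Pow (parcs G)"
      by (auto simp: in_connected_subgraphs)
    show "finite (Pow (pverts G) \<times> Pow (parcs G))"
      using pair_finite_verts pair_finite_arcs by simp
  qed
  show "inj_on (\<lambda>H. (pverts H, parcs H)) (connected_subgraphs G)"
    by (auto intro!: inj_onI pair_pre_digraph.equality)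
qed

section \<open>Components\<close>

text \<open>Adding arcs on the same vertices preserves connectedness, so a maximal connected
  subgraph is induced, hence symmetric, hence strongly connected. The theory of
  \<open>sccs_verts\<close> thereby applies to components.\<close>

lemma (in pair_graph) graph_components_eq_sccs: "graph_components G = sccs"
proof -
  have arc_mono: "arc_mono (Digraph_Component.connected :: ('a, 'a \<times> 'a) pre_digraph \<Rightarrow> bool)"
    unfolding arc_mono_def
    by (metis spanning_def subgraphE wf_digraph.connected_spanning_imp_connected)
  have sconn: "strongly_connected H"
    if "induced_subgraph H (with_proj G)" "Digraph_Component.connected H" for H
  proof -
    from that interpret H: wf_digraph H by auto
    have "symmetric H"
      using that(1) sym_arcs
      by (auto simp: symmetric_conv induced_subgraph_def subgraph_def compatible_def; force)
    with that(2) show ?thesis by (rule H.symmetric_connected_imp_strongly_connected[rotated])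
  qed
  have conn: "Digraph_Component.connected H"
    if "strongly_connected H" "wf_digraph H" for H :: "('a, 'a \<times> 'a) pre_digraph"
    using that wf_digraph.reachable_mk_symmetricI[OF that(2)]
    by (auto simp: connected_def strongly_connected_def)
  have "max_subgraph Digraph_Component.connected H \<longleftrightarrow> max_subgraph strongly_connected H" for H
  proof
    assume max: "max_subgraph Digraph_Component.connected H"
    then have "strongly_connected H"
      using sconn induced_subgraphI_arc_mono[OF max arc_mono] by (simp add: max_subgraph_def)
    with max show "max_subgraph strongly_connected H"
      using conn by (auto simp: max_subgraph_def)
  next
    assume max: "max_subgraph strongly_connected H"
    show "max_subgraph Digraph_Component.connected H"
    proof (rule max_subgraphI)
      show "subgraph H (with_proj G)" using max by (simp add: max_subgraph_def)
      with max show "Digraph_Component.connected H"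
        using conn by (auto simp: max_subgraph_def)
      fix K assume K: "H \<noteq> K" "subgraph H K" "subgraph K (with_proj G)"
      \<comment> \<open>\<open>K\<close> may lack reverse arcs, so it is replaced by the subgraph
        induced on its vertices, which is strongly connected. Maximality identifies that subgraph
        with \<open>H\<close>, and \<open>K\<close>, lying between the two, would equal
        \<open>H\<close>.\<close>
      let ?K = "with_proj G \<restriction> verts K"
      have ind: "induced_subgraph ?K (with_proj G)"
        using K(3) by (intro induced_induce) (auto simp: subgraph_def)
      have sub: "subgraph K ?K" using K(3) by (rule subgraph_induce_subgraphI2)
      show "\<not> Digraph_Component.connected K"
      proof
        assume "Digraph_Component.connected K"
        with arc_mono sub have "Digraph_Component.connected ?K"
          unfolding arc_mono_def by (metis induce_subgraph_verts)
        with ind have "strongly_connected ?K" by (rule sconn)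
        moreover have "subgraph H ?K" using K(2) sub by (rule subgraph_trans)
        ultimately have "?K = H" using max ind by (auto simp: max_subgraph_def)
        with sub K(1,2) show False
          by (auto simp: subgraph_def compatible_def)
      qed
    qed
  qed
  then show ?thesis by (simp add: graph_components_def sccs_altdef2)
qed

section \<open>Lower bound by counting sets of ends\<close>

text \<open>These are the sets \<open>{u, v}\<close> with \<open>u\<close> and \<open>v\<close> in
  one component, \<open>u = v\<close> allowed. Describing them by cardinality lets binomial
  coefficients count them.\<close>

definition (in pair_graph) end_sets :: "'a set set" where
  "end_sets = (\<Union>S\<in>sccs_verts. {X. X \<subseteq> S \<and> (card X = 1 \<or> card X = 2)})"

lemma (in pair_graph) finite_scc: "S \<in> sccs_verts \<Longrightarrow> finite S"
  using sccs_verts_subsets pair_finite_verts by (rule finite_subset)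

text \<open>A nonempty set lies in at most one component, and a component of size \<open>s\<close>
  contributes \<open>s + (s choose 2)\<close> sets. Doubling keeps the formula free of
  division.\<close>

lemma (in pair_graph) card_end_sets: "2 * card end_sets = (\<Sum>S\<in>sccs_verts. card S * (card S + 1))"
proof -
  have "card end_sets = (\<Sum>S\<in>sccs_verts. card {X. X \<subseteq> S \<and> (card X = 1 \<or> card X = 2)})"
    unfolding end_sets_def
  proof (rule card_UN_disjoint)
    show "finite sccs_verts" by (rule finite_sccs_verts)
    show "\<forall>S\<in>sccs_verts. finite {X. X \<subseteq> S \<and> (card X = 1 \<or> card X = 2)}"
      using finite_scc by auto
    show "\<forall>S\<in>sccs_verts. \<forall>T\<in>sccs_verts. S \<noteq> T \<longrightarrow>
      {X. X \<subseteq> S \<and> (card X = 1 \<or> card X = 2)} \<inter> {X. X \<subseteq> T \<and> (card X = 1 \<or> card X = 2)} = {}"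
    proof (intro ballI impI equals0I)
      fix S T X assume "S \<in> sccs_verts" "T \<in> sccs_verts" "S \<noteq> T" and
        X: "X \<in> {X. X \<subseteq> S \<and> (card X = 1 \<or> card X = 2)} \<inter> {X. X \<subseteq> T \<and> (card X = 1 \<or> card X = 2)}"
      then have "S \<inter> T = {}" by (intro sccs_verts_disjoint)
      with X have "X = {}" by blast
      with X show False by simp
    qed
  qed
  moreover have "2 * card {X. X \<subseteq> S \<and> (card X = 1 \<or> card X = 2)} = card S * (card S + 1)"
    if "S \<in> sccs_verts" for S
  proof -
    have "{X. X \<subseteq> S \<and> (card X = 1 \<or> card X = 2)} =
        {X. X \<subseteq> S \<and> card X = 1} \<union> {X. X \<subseteq> S \<and> card X = 2}" by auto
    also have "card \<dots> = (card S choose 1) + (card S choose 2)"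
      using finite_scc[OF that] by (subst card_Un_disjoint) (auto simp: n_subsets)
    finally have "card {X. X \<subseteq> S \<and> (card X = 1 \<or> card X = 2)} = card S + (card S choose 2)" by simp
    moreover have "2 * (card S choose 2) = card S * (card S - 1)"
      unfolding choose_two by (rule dvd_mult_div_cancel) (cases "card S", auto)
    ultimately show ?thesis by (cases "card S") auto
  qed
  ultimately show ?thesis by (simp add: sum_distrib_left)
qed

lemma (in pair_graph) sum_card_sccs_verts: "(\<Sum>S\<in>sccs_verts. card S) = card (pverts G)"
proof -
  have "pverts G = \<Union> sccs_verts"
    unfolding sccs_verts_conv_scc_of using in_scc_of_self by (auto simp: scc_of_def reachable_in_verts)
  moreover have "card (\<Union> sccs_verts) = (\<Sum>S\<in>sccs_verts. card S)"
    using sccs_verts_disjoint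
    by (intro card_Union_disjoint) (auto simp: pairwise_def disjnt_def intro: finite_scc)
  ultimately show ?thesis by simp
qed

lemma (in pair_graph) path_with_end_set:
  assumes "X \<in> end_sets"
  shows "\<exists>p. p \<noteq> [] \<and> distinct p \<and> {hd p, last p} = X \<and> list_graph p \<in> connected_subgraphs G"
proof -
  obtain S where S: "S \<in> sccs_verts" "X \<subseteq> S" "card X = 1 \<or> card X = 2"
    using assms by (auto simp: end_sets_def)
  \<comment> \<open>A singleton is read as \<open>{u, u}\<close>, so both cardinalities are served
    by a path from \<open>u\<close> to \<open>v\<close>.\<close>
  from S(3) have "\<exists>u v. X = {u, v}"
  proof
    assume "card X = 1"
    then obtain u where "X = {u}" by (rule card_1_singletonE)
    then have "X = {u, u}" by simp
    then show ?thesis by blast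
  next
    assume "card X = 2"
    then show ?thesis by (auto simp: card_2_iff)
  qed
  then obtain u v where uv: "X = {u, v}" by blast
  have uG: "u \<in> pverts G" using S uv sccs_verts_subsets by auto
  have "u \<rightarrow>\<^sup>*\<^bsub>with_proj G\<^esub> v" using S uv by (auto simp: in_sccs_verts_conv_reachable)
  then have "(u, v) \<in> (parcs G)\<^sup>*" using uG reachable_conv' by auto
  then obtain p where p: "p \<noteq> []" "distinct p" "hd p = u" "last p = v"
    "\<And>i. Suc i < length p \<Longrightarrow> (p ! i, p ! Suc i) \<in> parcs G"
    using rtrancl_distinct_list by metis
  have "p ! i \<in> pverts G" if "i < length p" for i
    using that
  proof (cases i)
    case 0
    with p uG show ?thesis by (simp add: hd_conv_nth)
  next
    case (Suc j)
    with that p(5)[of j] show ?thesis by (auto dest: in_arcsD2)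
  qed
  then have "list_graph p \<in> connected_subgraphs G"
    using p rtrancl_parcs_list_graph[of _ p] sym_parcs_list_graph[of p] arcs_symmetric
    unfolding in_connected_subgraphs
    by (auto simp: in_parcs_list_graph in_set_conv_nth)
  with p uv show ?thesis by blast
qed

text \<open>Choosing a path for each set of ends is injective, because the ends can be read off the
  path. If the two counts agree, this injection between finite sets is onto, so every connected
  subgraph is a chosen path.\<close>

lemma (in pair_graph) core_index_ge_card_end_sets:
  "card end_sets \<le> core_index G"
  "core_index G = card end_sets \<Longrightarrow> H \<in> connected_subgraphs G \<Longrightarrow>
     \<exists>p. distinct p \<and> H = list_graph p"
proof -
  obtain P where P: "\<And>X. X \<in> end_sets \<Longrightarrow> P X \<noteq> [] \<and> distinct (P X) \<and> {hd (P X), last (P X)} = X \<and>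
      list_graph (P X) \<in> connected_subgraphs G"
    using path_with_end_set by metis
  have inj: "inj_on (\<lambda>X. list_graph (P X)) end_sets"
  proof (rule inj_onI)
    fix X Y assume *: "X \<in> end_sets" "Y \<in> end_sets" "list_graph (P X) = list_graph (P Y)"
    then have "set (P X) = set (P Y)" by (metis pverts_list_graph)
    with * show "X = Y"
      using P[of X] P[of Y] ends_list_graph[of "P X"] ends_list_graph[of "P Y"] by simp
  qed
  have sub: "(\<lambda>X. list_graph (P X)) ` end_sets \<subseteq> connected_subgraphs G" using P by auto
  show "card end_sets \<le> core_index G"
    unfolding core_index_def using inj sub finite_connected_subgraphs by (rule card_inj_on_le)
  assume eq: "core_index G = card end_sets" and H: "H \<in> connected_subgraphs G"
  have "(\<lambda>X. list_graph (P X)) ` end_sets = connected_subgraphs G"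
    using eq card_image[OF inj] sub finite_connected_subgraphs
    by (metis card_subset_eq core_index_def)
  with H P show "\<exists>p. distinct p \<and> H = list_graph p" by blast
qed

text \<open>Arcs are reversible, so no arc leaves \<open>S\<close> and every walk between vertices
  of \<open>S\<close> stays inside. In the equality case this forces whole components to be
  paths.\<close>

lemma (in pair_graph) component_in_connected_subgraphs:
  assumes "S \<in> sccs_verts"
  shows "\<lparr>pverts = S, parcs = parcs G \<inter> S \<times> S\<rparr> \<in> connected_subgraphs G"
proof -
  have S: "S \<noteq> {}" "S \<subseteq> pverts G" "\<And>u v. u \<in> S \<Longrightarrow> v \<in> S \<Longrightarrow> (u, v) \<in> (parcs G)\<^sup>*"
    using assms sccs_verts_subsets[OF assms] reachable_conv
    by (auto simp: in_sccs_verts_conv_reachable)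
  have closed: "v \<in> S" if "u \<in> S" "(u, v) \<in> parcs G" for u v
  proof (rule ccontr)
    assume "v \<notin> S"
    moreover have "u \<rightarrow>\<^sup>*\<^bsub>with_proj G\<^esub> v" "v \<rightarrow>\<^sup>*\<^bsub>with_proj G\<^esub> u"
      using that arcs_symmetric by auto
    ultimately show False using assms that(1) by (auto simp: in_sccs_verts_conv_reachable)
  qed
  have "(u, v) \<in> (parcs G \<inter> S \<times> S)\<^sup>* \<and> v \<in> S" if "u \<in> S" "(u, v) \<in> (parcs G)\<^sup>*" for u v
    using that(2,1)
  proof (induction rule: rtrancl_induct)
    case (step y z)
    then show ?case using closed[of y z] by (auto intro: rtrancl_into_rtrancl)
  qed simp
  with S have "\<forall>u\<in>S. \<forall>v\<in>S. (u, v) \<in> (parcs G \<inter> S \<times> S)\<^sup>*" by blast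
  moreover have "sym (parcs G \<inter> S \<times> S)" using arcs_symmetric by (auto simp: sym_def)
  ultimately show ?thesis
    unfolding in_connected_subgraphs using S(1,2) by simp
qed

section \<open>Upper bound for unions of paths\<close>

text \<open>A discrete intermediate value theorem: \<open>f\<close> changes by exactly one along
  each arc, so a walk from at most \<open>m\<close> to above \<open>m\<close> must step from
  \<open>m\<close> to \<open>Suc m\<close>.\<close>

lemma rtrancl_crosses_level:
  fixes f :: "'a \<Rightarrow> nat"
  assumes "(u, v) \<in> E\<^sup>*" "\<And>x y. (x, y) \<in> E \<Longrightarrow> f y = Suc (f x) \<or> f x = Suc (f y)"
    and "f u \<le> m" "m < f v"
  shows "\<exists>x y. (x, y) \<in> E \<and> f x = m \<and> f y = Suc m"
  using assms(1,4)
proof (induction rule: rtrancl_induct)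
  case base
  with assms(3) show ?case by simp
next
  case (step y z)
  show ?case
  proof (cases "m < f y")
    case False
    with step assms(2)[OF step(2)] have "f y = m" "f z = Suc m" by auto
    with step show ?thesis by blast
  qed (use step in blast)
qed

text \<open>\<open>key\<close> names the path containing a vertex and \<open>pos\<close> its position on that path.\<close>

lemma (in pair_graph) core_index_linear_forest_le:
  fixes key :: "'a \<Rightarrow> 'k" and pos :: "'a \<Rightarrow> nat"
  assumes inj: "\<And>u v. u \<in> pverts G \<Longrightarrow> v \<in> pverts G \<Longrightarrow> key u = key v \<Longrightarrow> pos u = pos v \<Longrightarrow> u = v"
    and arcs: "\<And>u v. (u, v) \<in> parcs G \<Longrightarrow> key u = key v \<and> (pos v = Suc (pos u) \<or> pos u = Suc (pos v))"
    and T: "finite T" "\<And>v. v \<in> pverts G \<Longrightarrow> (key v, pos v) \<in> T"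
  shows "core_index G \<le> card (SIGMA (c, j):T. {..j})"
proof -
  \<comment> \<open>\<open>I\<close> yields the segment of path \<open>c\<close> from position
    \<open>i\<close> to position \<open>j\<close>. It suffices that its image covers all connected
    subgraphs.\<close>
  define I where "I = (\<lambda>((c, j), i).
    let S = {v \<in> pverts G. key v = c \<and> i \<le> pos v \<and> pos v \<le> j}
    in \<lparr>pverts = S, parcs = parcs G \<inter> S \<times> S\<rparr>)"
  have "H \<in> I ` (SIGMA (c, j):T. {..j})" if "H \<in> connected_subgraphs G" for H
  proof -
    have H: "pverts H \<subseteq> pverts G" "parcs H \<subseteq> parcs G" "parcs H \<subseteq> pverts H \<times> pverts H"
      "sym (parcs H)" "pverts H \<noteq> {}"
      "\<And>u v. u \<in> pverts H \<Longrightarrow> v \<in> pverts H \<Longrightarrow> (u, v) \<in> (parcs H)\<^sup>*"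
      using that by (auto simp: in_connected_subgraphs)
    have fin: "finite (pverts H)" using H(1) pair_finite_verts by (rule finite_subset)
    have key: "key u = key v" if "u \<in> pverts H" "v \<in> pverts H" for u v
      using H(6)[OF that]
    proof (induction rule: rtrancl_induct)
      case (step y z)
      with arcs H(2) show ?case by (metis subsetD)
    qed simp
    have cross: "\<exists>x y. (x, y) \<in> parcs H \<and> pos x = m \<and> pos y = Suc m"
      if "u \<in> pverts H" "v \<in> pverts H" "pos u \<le> m" "m < pos v" for u v m
      using H(6)[OF that(1,2)] _ that(3,4) by (rule rtrancl_crosses_level) (use H(2) arcs in blast)
    have "Min (pos ` pverts H) \<in> pos ` pverts H" using fin H(5) by auto
    then obtain a where a: "a \<in> pverts H" "pos a = Min (pos ` pverts H)" by force
    have "Max (pos ` pverts H) \<in> pos ` pverts H" using fin H(5) by auto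
    then obtain b where b: "b \<in> pverts H" "pos b = Max (pos ` pverts H)" by force
    have ab: "pos a \<le> pos v" "pos v \<le> pos b" if "v \<in> pverts H" for v
      using that a b fin by auto
    let ?S = "{v \<in> pverts G. key v = key b \<and> pos a \<le> pos v \<and> pos v \<le> pos b}"
    \<comment> \<open>\<open>H\<close> leaves no gap between its extreme positions: the walk from
      \<open>a\<close> to \<open>b\<close> crosses every level below \<open>pos b\<close>, and the
      top level is occupied by \<open>b\<close> itself.\<close>
    have "v \<in> pverts H" if v: "v \<in> ?S" for v
    proof (cases "pos v = pos b")
      case True
      with v b H(1) have "v = b" by (intro inj) auto
      with b show ?thesis by simp
    next
      case False
      with v cross[OF a(1) b(1), of "pos v"] obtain x where x: "x \<in> pverts H" "pos x = pos v"
        using H(3) by fastforce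
      then have "v = x" using v H(1) key[OF x(1) b(1)] by (intro inj) auto
      with x show ?thesis by simp
    qed
    moreover have "pverts H \<subseteq> ?S" using H(1) ab key[OF _ b(1)] by auto
    ultimately have S: "pverts H = ?S" by blast
    \<comment> \<open>Some arc of \<open>H\<close> crosses from the level of \<open>u\<close> to
      that of \<open>v\<close>; since \<open>key\<close> and \<open>pos\<close> determine a vertex,
      it is the arc \<open>(u, v)\<close>.\<close>
    have up: "(u, v) \<in> parcs H" if uv: "u \<in> pverts H" "v \<in> pverts H" "pos v = Suc (pos u)" for u v
    proof -
      obtain x y where xy: "(x, y) \<in> parcs H" "pos x = pos u" "pos y = Suc (pos u)"
        using cross[OF uv(1,2), of "pos u"] uv(3) by auto
      have "x = u" "y = v" using xy uv H(1,3) key by (auto intro!: inj)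
      with xy show ?thesis by simp
    qed
    have "parcs H = parcs G \<inter> pverts H \<times> pverts H"
    proof (intro equalityI subsetI)
      fix d assume "d \<in> parcs G \<inter> pverts H \<times> pverts H"
      then obtain u v where d: "d = (u, v)" "(u, v) \<in> parcs G" "u \<in> pverts H" "v \<in> pverts H"
        by blast
      from arcs[OF d(2)] have "(u, v) \<in> parcs H \<or> (v, u) \<in> parcs H"
        using up[OF d(3,4)] up[OF d(4,3)] by blast
      with d(1) symD[OF H(4)] show "d \<in> parcs H" by blast
    qed (use H(2,3) in blast)
    with S have "H = I ((key b, pos b), pos a)"
      by (auto simp: I_def Let_def intro!: pair_pre_digraph.equality)
    moreover have "((key b, pos b), pos a) \<in> (SIGMA (c, j):T. {..j})"
      using T(2)[of b] ab(2)[OF a(1)] b(1) H(1) by auto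
    ultimately show ?thesis by (rule image_eqI)
  qed
  then have "connected_subgraphs G \<subseteq> I ` (SIGMA (c, j):T. {..j})" by blast
  moreover have "finite (SIGMA (c, j):T. {..j})" using T(1) by auto
  ultimately show ?thesis
    unfolding core_index_def by (meson card_image_le card_mono finite_imageI le_trans)
qed

section \<open>The extremal graph and isomorphisms with it\<close>

text \<open>In both graphs tail and head are \<open>fst\<close> and \<open>snd\<close>, so the
  vertex map determines the arc map of an isomorphism.\<close>

lemma digraph_iso_with_proj_iff:
  fixes G :: "'a pair_pre_digraph" and H :: "'b pair_pre_digraph"
  assumes "pair_wf_digraph G"
  shows "digraph_iso (with_proj G) (with_proj H) \<longleftrightarrow>
    (\<exists>f. bij_betw f (pverts G) (pverts H) \<and> parcs H = map_prod f f ` parcs G)"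
proof
  interpret G: pair_wf_digraph G by fact
  assume "digraph_iso (with_proj G) (with_proj H)"
  then obtain g where iso: "G.digraph_isomorphism g" and H: "with_proj H = app_iso g (with_proj G)"
    by (auto simp: digraph_iso_def)
  have *: "pverts H = iso_verts g ` pverts G" "parcs H = iso_arcs g ` parcs G"
    "iso_tail g = fst" "iso_head g = snd"
    using H by (auto simp: with_proj_def app_iso_def)
  have "iso_arcs g a = map_prod (iso_verts g) (iso_verts g) a" if "a \<in> parcs G" for a
    using iso that *(3,4) unfolding G.digraph_isomorphism_def
    by (cases a) (auto intro!: prod_eqI)
  then have "parcs H = map_prod (iso_verts g) (iso_verts g) ` parcs G"
    unfolding *(2) by (rule image_cong[OF refl])
  moreover have "bij_betw (iso_verts g) (pverts G) (pverts H)"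
    using iso * by (auto simp: G.digraph_isomorphism_def bij_betw_def)
  ultimately show "\<exists>f. bij_betw f (pverts G) (pverts H) \<and> parcs H = map_prod f f ` parcs G"
    by blast
next
  interpret G: pair_wf_digraph G by fact
  assume "\<exists>f. bij_betw f (pverts G) (pverts H) \<and> parcs H = map_prod f f ` parcs G"
  then obtain f where f: "bij_betw f (pverts G) (pverts H)" "parcs H = map_prod f f ` parcs G"
    by blast
  let ?g = "\<lparr>iso_verts = f, iso_arcs = map_prod f f, iso_head = snd, iso_tail = fst\<rparr>"
  have inj: "inj_on f (pverts G)" using f(1) by (simp add: bij_betw_def)
  have "inj_on (map_prod f f) (parcs G)"
    by (rule inj_on_subset[OF map_prod_inj_on[OF inj inj]])
      (auto dest: G.in_arcsD1 G.in_arcsD2)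
  moreover have "wf_digraph (with_proj G)" by unfold_locales
  ultimately have "G.digraph_isomorphism ?g"
    unfolding G.digraph_isomorphism_def using inj by auto
  moreover have "with_proj H = app_iso ?g (with_proj G)"
    using f by (simp add: with_proj_def app_iso_def bij_betw_def)
  ultimately show "digraph_iso (with_proj G) (with_proj H)"
    unfolding digraph_iso_def by blast
qed

definition path_union ::
    "nat \<Rightarrow> nat \<Rightarrow> nat \<Rightarrow> ((nat \<times> nat) + (nat \<times> nat)) pair_pre_digraph" where
  "path_union r s q = disjoint_union (copies r (path_graph (q + 1))) (copies s (path_graph q))"

text \<open>Together with \<open>path_pos\<close> this gives coordinates on the extremal graph, in
  the roles of \<open>key\<close> and \<open>pos\<close>; \<open>Inl\<close> marks a long path and
  \<open>Inr\<close> a short one.\<close>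

definition path_index :: "(nat \<times> nat) + (nat \<times> nat) \<Rightarrow> nat + nat" where
  "path_index x = map_sum fst fst x"

definition path_pos :: "(nat \<times> nat) + (nat \<times> nat) \<Rightarrow> nat" where
  "path_pos x = case_sum snd snd x"

lemma path_index_pos_inject: "path_index x = path_index y \<Longrightarrow> path_pos x = path_pos y \<Longrightarrow> x = y"
  by (cases x; cases y) (auto simp: path_index_def path_pos_def prod_eq_iff)

lemma in_pverts_path_union:
  "x \<in> pverts (path_union r s q) \<longleftrightarrow> path_index x \<in> {..<r} <+> {..<s} \<and>
     path_pos x < case_sum (\<lambda>_. q + 1) (\<lambda>_. q) (path_index x)"
  by (cases x)
    (auto simp: path_union_def path_index_def path_pos_def disjoint_union_def copies_def path_graph_def)

lemma in_parcs_path_union: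
  "(x, y) \<in> parcs (path_union r s q) \<longleftrightarrow>
     x \<in> pverts (path_union r s q) \<and> y \<in> pverts (path_union r s q) \<and>
     path_index x = path_index y \<and> (path_pos y = Suc (path_pos x) \<or> path_pos x = Suc (path_pos y))"
  unfolding in_pverts_path_union
  by (cases x; cases y)
    (auto simp: path_union_def path_index_def path_pos_def disjoint_union_def copies_def path_graph_def)

lemma (in pair_graph) core_index_le_if_iso_path_union:
  assumes "digraph_iso (with_proj G) (with_proj (path_union r s q))"
  shows "2 * core_index G \<le> r * ((q + 1) * (q + 2)) + s * (q * (q + 1))"
proof -
  obtain f where f: "bij_betw f (pverts G) (pverts (path_union r s q))"
      "parcs (path_union r s q) = map_prod f f ` parcs G"
    using iffD1[OF digraph_iso_with_proj_iff[OF pair_wf_digraph] assms] by (elim exE conjE)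
  let ?T = "Inl ` {..<r} \<times> {..<q + 1} \<union> Inr ` {..<s} \<times> {..<q} :: ((nat + nat) \<times> nat) set"
  have "core_index G \<le> card (SIGMA (c, j):?T. {..j})"
  proof (rule core_index_linear_forest_le)
    show "u = v" if "u \<in> pverts G" "v \<in> pverts G" "path_index (f u) = path_index (f v)"
      "path_pos (f u) = path_pos (f v)" for u v
      using path_index_pos_inject[OF that(3,4)] that(1,2) f(1)
      by (auto simp: bij_betw_def inj_on_def)
    show "path_index (f u) = path_index (f v) \<and>
        (path_pos (f v) = Suc (path_pos (f u)) \<or> path_pos (f u) = Suc (path_pos (f v)))"
      if "(u, v) \<in> parcs G" for u v
    proof -
      have "(f u, f v) \<in> parcs (path_union r s q)" using that f(2) by force
      then show ?thesis unfolding in_parcs_path_union by simp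
    qed
    show "(path_index (f v), path_pos (f v)) \<in> ?T" if "v \<in> pverts G" for v
    proof -
      have "f v \<in> pverts (path_union r s q)" using that f(1) by (auto simp: bij_betw_def)
      then show ?thesis unfolding in_pverts_path_union by auto
    qed
  qed simp
  \<comment> \<open>An upper end at position \<open>j\<close> admits the \<open>Suc j\<close> lower
    ends 0 to \<open>j\<close>.\<close>
  also have "card (SIGMA (c, j):?T. {..j}) = (\<Sum>(c, j)\<in>?T. Suc j)"
    by (subst card_SigmaI) (auto simp: case_prod_beta)
  also have "\<dots> = (\<Sum>(c, j)\<in>(Inl ` {..<r} :: (nat + nat) set) \<times> {..<q + 1}. Suc j) +
      (\<Sum>(c, j)\<in>(Inr ` {..<s} :: (nat + nat) set) \<times> {..<q}. Suc j)"
    by (rule sum.union_disjoint) auto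
  also have "\<dots> = r * (\<Sum>j<q + 1. Suc j) + s * (\<Sum>j<q. Suc j)"
    by (simp add: sum.cartesian_product[symmetric] card_image)
  finally have "2 * core_index G \<le> r * (2 * (\<Sum>j<q + 1. Suc j)) + s * (2 * (\<Sum>j<q. Suc j))"
    by (simp add: algebra_simps)
  moreover have "2 * (\<Sum>j<m. Suc j) = m * (m + 1)" for m
    by (induction m) auto
  ultimately show ?thesis by (metis add.assoc one_add_one)
qed

text \<open>Components of each size are enumerated and matched with the copies of the path of that
  size; position \<open>i\<close> of a copy goes to entry \<open>i\<close> of the list for its
  component.\<close>

lemma (in pair_graph) iso_path_union_if_components_paths:
  assumes paths: "\<And>S. S \<in> sccs_verts \<Longrightarrow>
      \<exists>p. distinct p \<and> \<lparr>pverts = S, parcs = parcs G \<inter> S \<times> S\<rparr> = list_graph p"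
    and sizes: "\<And>S. S \<in> sccs_verts \<Longrightarrow> card S = q + 1 \<or> card S = q"
    and long: "card {S \<in> sccs_verts. card S = q + 1} = r"
    and short: "card {S \<in> sccs_verts. card S = q} = s"
  shows "digraph_iso (with_proj G) (with_proj (path_union r s q))"
proof -
  obtain p where "\<And>S. S \<in> sccs_verts \<Longrightarrow>
      distinct (p S) \<and> \<lparr>pverts = S, parcs = parcs G \<inter> S \<times> S\<rparr> = list_graph (p S)"
    using paths by metis
  then have p: "distinct (p S)" "set (p S) = S" "parcs G \<inter> S \<times> S = parcs (list_graph (p S))"
    if "S \<in> sccs_verts" for S
    using that by (metis pair_pre_digraph.select_convs pverts_list_graph)+
  have len: "length (p S) = card S" if "S \<in> sccs_verts" for S
    using p[OF that] by (metis distinct_card)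
  obtain e1 where e1: "bij_betw e1 {..<r} {S \<in> sccs_verts. card S = q + 1}"
    using ex_bij_betw_nat_finite[of "{S \<in> sccs_verts. card S = q + 1}"] finite_sccs_verts long
    by (auto simp: atLeast0LessThan)
  obtain e2 where e2: "bij_betw e2 {..<s} {S \<in> sccs_verts. card S = q}"
    using ex_bij_betw_nat_finite[of "{S \<in> sccs_verts. card S = q}"] finite_sccs_verts short
    by (auto simp: atLeast0LessThan)
  define e where "e = case_sum e1 e2"
  let ?K = "{..<r} <+> {..<s}"
  have e: "e c \<in> sccs_verts" "card (e c) = case_sum (\<lambda>_. q + 1) (\<lambda>_. q) c" if "c \<in> ?K" for c
    using that e1 e2 by (auto simp: e_def bij_betw_def)
  have e_inj: "c = d" if "c \<in> ?K" "d \<in> ?K" "e c = e d" for c d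
  proof -
    \<comment> \<open>The sizes \<open>q + 1\<close> and \<open>q\<close> differ, so
      \<open>c\<close> and \<open>d\<close> lie on the same side of the sum, where \<open>e1\<close>
      or \<open>e2\<close> is injective.\<close>
    have "case_sum (\<lambda>_. q + 1) (\<lambda>_. q) c = case_sum (\<lambda>_. q + 1) (\<lambda>_. q) d"
      using e(2)[OF that(1)] e(2)[OF that(2)] that(3) by simp
    then show ?thesis
      using that e1 e2 by (auto simp: e_def bij_betw_def inj_on_def)
  qed
  have e_surj: "\<exists>c\<in>?K. S = e c" if "S \<in> sccs_verts" for S
  proof -
    have "S \<in> e1 ` {..<r} \<or> S \<in> e2 ` {..<s}"
      using that sizes[OF that] e1 e2 by (auto simp: bij_betw_def)
    then show ?thesis by (auto simp: e_def intro: bexI[of _ "Inl _"] bexI[of _ "Inr _"])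
  qed
  let ?W = "pverts (path_union r s q)"
  define h where "h x = p (e (path_index x)) ! path_pos x" for x
  have W: "x \<in> ?W \<longleftrightarrow> path_index x \<in> ?K \<and> path_pos x < length (p (e (path_index x)))" for x
    unfolding in_pverts_path_union using e[of "path_index x"] len[of "e (path_index x)"]
    by (simp cong: conj_cong)
  have mk: "\<exists>x. path_index x = c \<and> path_pos x = i" for c i
  proof (cases c)
    case (Inl a)
    then show ?thesis by (intro exI[of _ "Inl (a, i)"]) (simp add: path_index_def path_pos_def)
  next
    case (Inr a)
    then show ?thesis by (intro exI[of _ "Inr (a, i)"]) (simp add: path_index_def path_pos_def)
  qed
  have h_in: "h x \<in> e (path_index x)" if "x \<in> ?W" for x
  proof -
    have "path_index x \<in> ?K" "path_pos x < length (p (e (path_index x)))"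
      using that unfolding W by simp_all
    then show ?thesis using p(2)[OF e(1)] nth_mem unfolding h_def by metis
  qed
  have inj: "inj_on h ?W"
  proof (rule inj_onI)
    fix x y assume xy: "x \<in> ?W" "y \<in> ?W" "h x = h y"
    then have "e (path_index x) \<inter> e (path_index y) \<noteq> {}" using h_in by fastforce
    then have "e (path_index x) = e (path_index y)"
      using xy e(1) W sccs_verts_disjoint by metis
    then have "path_index x = path_index y" using xy e_inj W by blast
    moreover from this have "path_pos x = path_pos y"
      using xy p(1)[OF e(1), of "path_index y"] by (simp add: W h_def nth_eq_iff_index_eq)
    ultimately show "x = y" by (rule path_index_pos_inject)
  qed
  have surj: "\<exists>x\<in>?W. v = h x \<and> path_index x = c" if "c \<in> ?K" "v \<in> e c" for c v
  proof -
    have "v \<in> set (p (e c))" using that(2) p(2)[OF e(1)[OF that(1)]] by simp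
    then obtain i where i: "i < length (p (e c))" "v = p (e c) ! i"
      by (auto simp: in_set_conv_nth)
    obtain x where x: "path_index x = c" "path_pos x = i" using mk by metis
    with i that have "x \<in> ?W" by (simp add: W)
    moreover have "v = h x" using i x by (simp add: h_def)
    ultimately show ?thesis using x by blast
  qed
  have scc: "\<exists>c\<in>?K. v \<in> e c" if "v \<in> pverts G" for v
    using e_surj[OF scc_of_in_sccs_verts[OF that]] in_scc_of_self[OF that] by auto
  have image: "h ` ?W = pverts G"
  proof
    show "h ` ?W \<subseteq> pverts G"
      using h_in W e(1) sccs_verts_subsets by blast
    show "pverts G \<subseteq> h ` ?W" using scc surj by blast
  qed
  have arcs_iff: "(h x, h y) \<in> parcs G \<longleftrightarrow> (x, y) \<in> parcs (path_union r s q)"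
    if xy: "x \<in> ?W" "y \<in> ?W" for x y
  proof
    assume arc: "(h x, h y) \<in> parcs G"
    let ?S = "e (path_index x)"
    have S: "?S \<in> sccs_verts" "h x \<in> ?S" using xy h_in e(1) W by auto
    \<comment> \<open>Reachability in both directions puts \<open>h y\<close> into the component of
      \<open>h x\<close>, so the arc belongs to the list graph of that component.\<close>
    have reach: "h x \<rightarrow>\<^sup>*\<^bsub>with_proj G\<^esub> h y" "h y \<rightarrow>\<^sup>*\<^bsub>with_proj G\<^esub> h x"
      using arc arcs_symmetric by auto
    then have "h y \<in> ?S" using S unfolding in_sccs_verts_conv_reachable by blast
    then have "e (path_index y) \<inter> ?S \<noteq> {}" using h_in[OF xy(2)] by blast
    then have "e (path_index y) = ?S"
      using sccs_verts_disjoint[OF e(1) S(1)] xy(2) W by blast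
    then have "path_index y = path_index x" using xy W by (intro e_inj) auto
    moreover have "(h x, h y) \<in> parcs (list_graph (p ?S))"
      using arc S \<open>h y \<in> ?S\<close> p(3)[OF S(1)] by blast
    ultimately show "(x, y) \<in> parcs (path_union r s q)"
      using xy p(1)[OF S(1)] unfolding in_parcs_path_union in_parcs_list_graph W h_def
      by (auto simp: nth_eq_iff_index_eq)
  next
    assume "(x, y) \<in> parcs (path_union r s q)"
    then have *: "path_index x = path_index y"
        "path_pos y = Suc (path_pos x) \<or> path_pos x = Suc (path_pos y)"
      unfolding in_parcs_path_union by auto
    let ?S = "e (path_index x)"
    have S: "?S \<in> sccs_verts" using xy e(1) W by auto
    have "(h x, h y) \<in> parcs (list_graph (p ?S))"
      using xy * unfolding in_parcs_list_graph W h_def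
      by (intro exI[of _ "path_pos x"] exI[of _ "path_pos y"]) simp
    with p(3)[OF S] show "(h x, h y) \<in> parcs G" by blast
  qed
  \<comment> \<open>\<open>h\<close> maps the extremal graph to \<open>G\<close>, while the
    isomorphism has to start from \<open>G\<close>.\<close>
  let ?f = "the_inv_into ?W h"
  have bij: "bij_betw ?f (pverts G) ?W"
    by (rule bij_betw_the_inv_into) (rule bij_betw_imageI[OF inj image])
  have fh: "?f (h x) = x" if "x \<in> ?W" for x using inj that by (rule the_inv_into_f_f)
  have "parcs (path_union r s q) = map_prod ?f ?f ` parcs G"
  proof (intro equalityI subsetI)
    fix a assume a: "a \<in> parcs (path_union r s q)"
    obtain x y where xy: "a = (x, y)" by (cases a)
    with a have W': "x \<in> ?W" "y \<in> ?W" by (simp_all add: in_parcs_path_union)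
    with a xy have "(h x, h y) \<in> parcs G" using arcs_iff by simp
    moreover have "a = map_prod ?f ?f (h x, h y)" using xy W' fh by simp
    ultimately show "a \<in> map_prod ?f ?f ` parcs G" by (rule rev_image_eqI)
  next
    fix a assume "a \<in> map_prod ?f ?f ` parcs G"
    then obtain u v where uv: "(u, v) \<in> parcs G" "a = (?f u, ?f v)" by auto
    then have "u \<in> h ` ?W" "v \<in> h ` ?W" unfolding image by (auto dest: in_arcsD1 in_arcsD2)
    then obtain x y where "x \<in> ?W" "y \<in> ?W" "u = h x" "v = h y" by blast
    with uv arcs_iff fh show "a \<in> parcs (path_union r s q)" by simp
  qed
  with bij show ?thesis by (intro iffD2[OF digraph_iso_with_proj_iff[OF pair_wf_digraph]] exI conjI)
qed

section \<open>Arithmetic and the final bound\<close>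

lemma sum_mult_Suc_ge:
  fixes f :: "'b \<Rightarrow> nat"
  assumes "finite A" "card A = k" "sum f A = k * q + r"
  shows "2 * (r * (q + 1)) + k * (q * (q + 1)) \<le> (\<Sum>a\<in>A. f a * (f a + 1))"
    and "(\<Sum>a\<in>A. f a * (f a + 1)) = 2 * (r * (q + 1)) + k * (q * (q + 1)) \<Longrightarrow> a \<in> A \<Longrightarrow>
      f a = q + 1 \<or> f a = q"
proof -
  \<comment> \<open>A product of two consecutive integers is nonnegative and vanishes only at
    \<open>f a = q\<close> or \<open>f a = q + 1\<close>. Integers avoid truncated
    subtraction.\<close>
  define g where "g a = (int (f a) - int q) * (int (f a) - int q - 1)" for a
  have g: "0 \<le> g a" for a
    unfolding g_def by (cases "int (f a) \<le> int q") (auto simp: mult_nonpos_nonpos)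
  have "(\<Sum>a\<in>A. int (f a * (f a + 1))) =
      (\<Sum>a\<in>A. g a + (2 * int q + 2) * int (f a) - int q * (int q + 1))"
    by (rule sum.cong) (auto simp: g_def algebra_simps)
  also have "\<dots> = sum g A + (2 * int q + 2) * int (sum f A) - int k * (int q * (int q + 1))"
    by (simp add: sum.distrib sum_subtractf sum_distrib_left assms(2))
  also have "\<dots> = sum g A + int (2 * (r * (q + 1)) + k * (q * (q + 1)))"
    by (simp add: assms(3) algebra_simps)
  finally have eq: "int (\<Sum>a\<in>A. f a * (f a + 1)) = sum g A + int (2 * (r * (q + 1)) + k * (q * (q + 1)))"
    by simp
  have "0 \<le> sum g A" using g by (simp add: sum_nonneg)
  with eq show "2 * (r * (q + 1)) + k * (q * (q + 1)) \<le> (\<Sum>a\<in>A. f a * (f a + 1))"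
    by linarith
  assume "(\<Sum>a\<in>A. f a * (f a + 1)) = 2 * (r * (q + 1)) + k * (q * (q + 1))" and a: "a \<in> A"
  with eq have "sum g A = 0" by linarith
  then have "g a = 0" using sum_nonneg_eq_0_iff[OF assms(1), of g] g a by blast
  then show "f a = q + 1 \<or> f a = q" unfolding g_def by auto
qed

lemma (in pair_graph) core_index_bound:
  assumes "card sccs_verts = k" "card (pverts G) = k * q + r" "r < k"
  shows "2 * (r * (q + 1)) + k * (q * (q + 1)) \<le> 2 * core_index G"
    and "2 * core_index G = 2 * (r * (q + 1)) + k * (q * (q + 1)) \<longleftrightarrow>
      digraph_iso (with_proj G) (with_proj (path_union r (k - r) q))"
proof -
  let ?B = "2 * (r * (q + 1)) + k * (q * (q + 1))"
  note sizes = sum_mult_Suc_ge[OF finite_sccs_verts assms(1) sum_card_sccs_verts[unfolded assms(2)]]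
  show bound: "?B \<le> 2 * core_index G"
    using sizes(1) core_index_ge_card_end_sets(1) card_end_sets by linarith
  show "2 * core_index G = ?B \<longleftrightarrow> digraph_iso (with_proj G) (with_proj (path_union r (k - r) q))"
  proof
    \<comment> \<open>Equality collapses the chain from \<open>?B\<close> over the sum of
      \<open>card S * (card S + 1)\<close>, which is \<open>2 * card end_sets\<close>, up to
      \<open>2 * core_index G\<close>.\<close>
    assume F: "2 * core_index G = ?B"
    then have D: "core_index G = card end_sets" "(\<Sum>S\<in>sccs_verts. card S * (card S + 1)) = ?B"
      using sizes(1) core_index_ge_card_end_sets(1) card_end_sets by linarith+
    have card_S: "card S = q + 1 \<or> card S = q" if "S \<in> sccs_verts" for S
      using sizes(2)[OF D(2) that] .
    let ?L = "{S \<in> sccs_verts. card S = q + 1}" and ?M = "{S \<in> sccs_verts. card S = q}"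
    have LM: "?L \<union> ?M = sccs_verts" using card_S by blast
    have fin: "finite ?L" "finite ?M" using finite_sccs_verts by simp_all
    have disj: "?L \<inter> ?M = {}" by auto
    have k: "card ?L + card ?M = k"
      using card_Un_disjoint[OF fin disj] assms(1) unfolding LM by simp
    \<comment> \<open>Each long component exceeds size \<open>q\<close> by one vertex, so the total
      \<open>k * q + r\<close> forces exactly \<open>r\<close> of them.\<close>
    have "k * q + r = sum card ?L + sum card ?M"
      using sum.union_disjoint[OF fin disj, of card] sum_card_sccs_verts assms(2)
      unfolding LM by simp
    also have "\<dots> = card ?L * (q + 1) + card ?M * q" by simp
    also have "\<dots> = (card ?L + card ?M) * q + card ?L" by (simp add: algebra_simps)
    finally have "card ?L = r" using k by simp
    moreover from this k have "card ?M = k - r" by simp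
    ultimately show "digraph_iso (with_proj G) (with_proj (path_union r (k - r) q))"
      using core_index_ge_card_end_sets(2)[OF D(1) component_in_connected_subgraphs] card_S
      by (intro iso_path_union_if_components_paths)
  next
    assume "digraph_iso (with_proj G) (with_proj (path_union r (k - r) q))"
    then have "2 * core_index G \<le> r * ((q + 1) * (q + 2)) + (k - r) * (q * (q + 1))"
      by (rule core_index_le_if_iso_path_union)
    \<comment> \<open>Since \<open>(q + 1) * (q + 2)\<close> is
      \<open>q * (q + 1) + 2 * (q + 1)\<close>, the upper bound is \<open>?B\<close> and meets the
      lower bound.\<close>
    also have "\<dots> = 2 * (r * (q + 1)) + (r + (k - r)) * (q * (q + 1))"
      by (simp only: algebra_simps)
    also have "r + (k - r) = k" using assms(3) by simp
    finally show "2 * core_index G = ?B" using bound by simp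
  qed
qed

theorem theorem2p5:
  fixes G :: "'a pair_pre_digraph" and n k q r :: nat
  assumes "pair_graph G"
    and "0 < n" and "0 < k" and "k \<le> n"
    and "n = k * q + r" and "r < k"
    and "card (pverts G) = n"
    and "card (graph_components G) = k"
  shows "real (core_index G) \<ge> real r * (real q + 1) + real k * real q * (real q + 1) / 2 \<and>
    (real (core_index G) = real r * (real q + 1) + real k * real q * (real q + 1) / 2 \<longleftrightarrow>
      digraph_iso (with_proj G)
        (with_proj (disjoint_union (copies r (path_graph (q + 1)))
                                   (copies (k - r) (path_graph q)))))"
proof -
  interpret pair_graph G by fact
  have "card sccs_verts = k"
    using assms(8) card_sccs_verts by (simp add: graph_components_eq_sccs)
  note bound = core_index_bound[OF this assms(7)[unfolded assms(5)] assms(6)]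
  \<comment> \<open>The doubled statements over the naturals are halved in the reals.\<close>
  have B: "real r * (real q + 1) + real k * real q * (real q + 1) / 2 =
      real (2 * (r * (q + 1)) + k * (q * (q + 1))) / 2"
    by (simp add: algebra_simps)
  have F: "real (core_index G) = real (2 * core_index G) / 2" by simp
  have "real (2 * (r * (q + 1)) + k * (q * (q + 1))) / 2 \<le> real (2 * core_index G) / 2"
    using bound(1) by (intro divide_right_mono of_nat_mono) auto
  moreover have "real (2 * core_index G) / 2 = real (2 * (r * (q + 1)) + k * (q * (q + 1))) / 2 \<longleftrightarrow>
      2 * core_index G = 2 * (r * (q + 1)) + k * (q * (q + 1))"
    by (simp only: divide_cancel_right of_nat_eq_iff) simp
  ultimately show ?thesis
    unfolding B F bound(2) path_union_def by simp
qed

end
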